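(* Let $m\geq 3$ and $h\geq 1$ be integers with $(m,h)\notin\{(3,1),(4,1)\}$, let $n=m^h$, and let $\overline{\Gamma_{m^h}}=\overline{C_{m^h}(1,m,m^2,\ldots,m^{h-1})}$ be the complement of the circulant graph $C_{m^h}(1,m,m^2,\ldots,m^{h-1})$. Then: (i) $W(\overline{\Gamma_{m^h}})=\frac{n(n+2h-1)}{2}$; (ii) $S(\overline{\Gamma_{m^h}})=n(n-2h-1)(n+2h-1)$; (iii) $G(\overline{\Gamma_{m^h}})=\frac{n(n+2h-1)(n-2h-1)^2}{2}$; (iv) $WW(\overline{\Gamma_{m^h}})=\frac{n(n+4h-1)}{2}$; (v) $H(\overline{\Gamma_{m^h}})=\frac{n(n-h-1)}{2}$; (vi) $H_A(\overline{\Gamma_{m^h}})=n(n-2h-1)(n-h-1)$; (vii) $H_M(\overline{\Gamma_{m^h}})=\frac{n(n-h-1)(n-2h-1)^2}{2}$; (viii) $T_{AG}(\overline{\Gamma_{m^h}})=\frac{n(n-2h-1)}{2}$; (ix) $T_{GA}(\overline{\Gamma_{m^h}})=\frac{n(n-2h-1)}{2}$; (x) $T_{SC}(\overline{\Gamma_{m^h}})=\frac{n(n-2h-1)}{2\sqrt{2}\sqrt{n+2h-1}}$; (xi) $T_{ABC}(\overline{\Gamma_{m^h}})=\frac{n(n-2h-1)\sqrt{n+2h-2}}{\sqrt{2}(n+2h-1)}$; (xii) $T_{AZ}(\overline{\Gamma_{m^h}})=\frac{n(n-2h-1)(n+2h-1)^6}{16(n+2h-2)^3}$; (xiii) $RT_{AG}(\overline{\Gamma_{m^h}})=\frac{n(n-2h-1)}{2}$;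 (xiv) $RT_{GA}(\overline{\Gamma_{m^h}})=\frac{n(n-2h-1)}{2}$; (xv) $RT_{SC}(\overline{\Gamma_{m^h}})=\frac{n(n-2h-1)}{2\sqrt{2}\sqrt{n-h-1}}$; (xvi) $RT_{ABC}(\overline{\Gamma_{m^h}})=\frac{n(n-2h-1)\sqrt{n-h-2}}{\sqrt{2}(n-h-1)}$; (xvii) $RT_{AZ}(\overline{\Gamma_{m^h}})=\frac{n(1+2h-n)(1+h-n)^6}{16(2+h-n)^3}$.
   Context: For $S\subseteq\mathbb{Z}_n\setminus\{0\}$, the circulant graph $C_n(S)$ is the simple undirected graph with vertex set $\mathbb{Z}_n$ and edge set $\{\{g,g+s\}: g\in\mathbb{Z}_n, s\in S\}$ (addition mod $n$); $C_n(s_1,\ldots,s_t)$ means $C_n(\{s_1,\ldots,s_t\})$. $\overline{\Gamma}$ denotes the complement of $\Gamma$. For a connected graph $\Gamma$, let $d(u,v)$ be the shortest-path distance, $\deg(v)$ the degree, $\sigma(v)=\sum_{u\neq v}d(u,v)$ the transmission of $v$, and $rs(v)=\sum_{u\neq v}\frac{1}{d(u,v)}$ the reciprocal transmission of $v$. Below, $\sum_{\{u,v\}}$ is over unordered pairs of distinct vertices and $\sum_{uv\in E}$ is over (undirected) edges of $\Gamma$. The indices are: $W=\sum_{\{u,v\}}d(u,v)$ (Wiener); $WW=\frac12\sum_{\{u,v\}}[d(u,v)+d(u,v)^2]$ (hyper-Wiener); $H=\sum_{\{u,v\}}\frac{1}{d(u,v)}$ (Harary); $S=\sum_{\{u,v\}}[\deg(u)+\deg(v)]d(u,v)$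 (Schultz); $G=\sum_{\{u,v\}}\deg(u)\deg(v)d(u,v)$ (Gutman); $H_A=\sum_{\{u,v\}}\frac{\deg(u)+\deg(v)}{d(u,v)}$ and $H_M=\sum_{\{u,v\}}\frac{\deg(u)\deg(v)}{d(u,v)}$ (additively and multiplicatively weighted Harary); $T_{GA}=\sum_{uv\in E}\frac{2\sqrt{\sigma(u)\sigma(v)}}{\sigma(u)+\sigma(v)}$; $T_{AG}=\sum_{uv\in E}\frac{\sigma(u)+\sigma(v)}{2\sqrt{\sigma(u)\sigma(v)}}$; $T_{SC}=\sum_{uv\in E}\frac{1}{\sqrt{\sigma(u)+\sigma(v)}}$; $T_{ABC}=\sum_{uv\in E}\sqrt{\frac{\sigma(u)+\sigma(v)-2}{\sigma(u)\sigma(v)}}$; $T_{AZ}=\sum_{uv\in E}\left[\frac{\sigma(u)\sigma(v)}{\sigma(u)+\sigma(v)-2}\right]^3$; and $RT_{GA},RT_{AG},RT_{SC},RT_{ABC},RT_{AZ}$ are defined by the same formulas as $T_{GA},T_{AG},T_{SC},T_{ABC},T_{AZ}$ respectively, with $\sigma$ replaced by $rs$. *)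

theory Defs
  imports Complex_Main
begin

text \<open>Edges are two-element sets of vertices.\<close>

record 'a ugraph =
  verts :: "'a set"
  edges :: "'a set set"

definition complement :: "'a ugraph \<Rightarrow> 'a ugraph" where
  "complement G =
     \<lparr>verts = verts G,
      edges = {{u, v} | u v. u \<in> verts G \<and> v \<in> verts G \<and> u \<noteq> v \<and> {u, v} \<notin> edges G}\<rparr>"

text \<open>The group \<open>\<int>\<^sub>n\<close> is represented by the residues \<open>0, \<dots>, n - 1\<close>, and the
  connection set satisfies \<open>S \<subseteq> {1..<n}\<close> (so that no singleton edges arise); it need not be
  closed under negation.\<close>

definition circulant :: "nat \<Rightarrow> nat set \<Rightarrow> nat ugraph" where
  "circulant n S =
     \<lparr>verts = {..<n}, edges = {{g, (g + s) mod n} | g s. g < n \<and> s \<in> S}\<rparr>"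

text \<open>A walk is given by its nonempty list of vertices; it has one edge less than vertices.\<close>

definition walk_betw :: "'a ugraph \<Rightarrow> 'a \<Rightarrow> 'a list \<Rightarrow> 'a \<Rightarrow> bool" where
  "walk_betw G u p v \<longleftrightarrow>
     p \<noteq> [] \<and> set p \<subseteq> verts G \<and> hd p = u \<and> last p = v \<and>
     successively (\<lambda>x y. {x, y} \<in> edges G) p"

definition connected_ugraph :: "'a ugraph \<Rightarrow> bool" where
  "connected_ugraph G \<longleftrightarrow>
     verts G \<noteq> {} \<and> (\<forall>u\<in>verts G. \<forall>v\<in>verts G. \<exists>p. walk_betw G u p v)"

text \<open>The distance is meaningful only if some walk joins \<open>u\<close> and \<open>v\<close>.\<close>

definition gdist :: "'a ugraph \<Rightarrow> 'a \<Rightarrow> 'a \<Rightarrow> nat" where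
  "gdist G u v = (LEAST k. \<exists>p. walk_betw G u p v \<and> length p = Suc k)"

definition degree :: "'a ugraph \<Rightarrow> 'a \<Rightarrow> nat" where
  "degree G v = card {e \<in> edges G. v \<in> e}"

definition transmission :: "'a ugraph \<Rightarrow> 'a \<Rightarrow> real" where
  "transmission G v = (\<Sum>u\<in>verts G - {v}. real (gdist G u v))"

definition reciprocal_transmission :: "'a ugraph \<Rightarrow> 'a \<Rightarrow> real" where
  "reciprocal_transmission G v = (\<Sum>u\<in>verts G - {v}. 1 / real (gdist G u v))"

definition vertex_pairs :: "'a ugraph \<Rightarrow> 'a set set" where
  "vertex_pairs G = {{u, v} | u v. u \<in> verts G \<and> v \<in> verts G \<and> u \<noteq> v}"

text \<open>The value of a symmetric function \<open>f\<close> on an unordered pair; each unordered pair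
  contributes once to \<open>pair_sum\<close>.\<close>

definition on_pair :: "('a \<Rightarrow> 'a \<Rightarrow> real) \<Rightarrow> 'a set \<Rightarrow> real" where
  "on_pair f e = (THE x. \<exists>u v. e = {u, v} \<and> x = f u v)"

lemma on_pair_eq:
  assumes "f u v = f v u"
  shows "on_pair f {u, v} = f u v"
  unfolding on_pair_def using assms by (auto simp: doubleton_eq_iff intro!: the_equality)

definition pair_sum :: "'a set set \<Rightarrow> ('a \<Rightarrow> 'a \<Rightarrow> real) \<Rightarrow> real" where
  "pair_sum P f = (\<Sum>e\<in>P. on_pair f e)"

definition wiener :: "'a ugraph \<Rightarrow> real" where
  "wiener G = pair_sum (vertex_pairs G) (\<lambda>u v. real (gdist G u v))"

definition hyper_wiener :: "'a ugraph \<Rightarrow> real" where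
  "hyper_wiener G =
     1 / 2 * pair_sum (vertex_pairs G) (\<lambda>u v. real (gdist G u v) + real (gdist G u v) ^ 2)"

definition harary :: "'a ugraph \<Rightarrow> real" where
  "harary G = pair_sum (vertex_pairs G) (\<lambda>u v. 1 / real (gdist G u v))"

definition schultz :: "'a ugraph \<Rightarrow> real" where
  "schultz G = pair_sum (vertex_pairs G)
     (\<lambda>u v. (real (degree G u) + real (degree G v)) * real (gdist G u v))"

definition gutman :: "'a ugraph \<Rightarrow> real" where
  "gutman G = pair_sum (vertex_pairs G)
     (\<lambda>u v. real (degree G u) * real (degree G v) * real (gdist G u v))"

definition harary_add :: "'a ugraph \<Rightarrow> real" where
  "harary_add G = pair_sum (vertex_pairs G)
     (\<lambda>u v. (real (degree G u) + real (degree G v)) / real (gdist G u v))"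

definition harary_mult :: "'a ugraph \<Rightarrow> real" where
  "harary_mult G = pair_sum (vertex_pairs G)
     (\<lambda>u v. (real (degree G u) * real (degree G v)) / real (gdist G u v))"

text \<open>The transmission and reciprocal transmission indices are given by the same five formulas,
  for the weights \<open>transmission G\<close> and \<open>reciprocal_transmission G\<close>.\<close>

definition weight_GA :: "'a ugraph \<Rightarrow> ('a \<Rightarrow> real) \<Rightarrow> real" where
  "weight_GA G w = pair_sum (edges G) (\<lambda>u v. 2 * sqrt (w u * w v) / (w u + w v))"

definition weight_AG :: "'a ugraph \<Rightarrow> ('a \<Rightarrow> real) \<Rightarrow> real" where
  "weight_AG G w = pair_sum (edges G) (\<lambda>u v. (w u + w v) / (2 * sqrt (w u * w v)))"

definition weight_SC :: "'a ugraph \<Rightarrow> ('a \<Rightarrow> real) \<Rightarrow> real" where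
  "weight_SC G w = pair_sum (edges G) (\<lambda>u v. 1 / sqrt (w u + w v))"

definition weight_ABC :: "'a ugraph \<Rightarrow> ('a \<Rightarrow> real) \<Rightarrow> real" where
  "weight_ABC G w = pair_sum (edges G) (\<lambda>u v. sqrt ((w u + w v - 2) / (w u * w v)))"

definition weight_AZ :: "'a ugraph \<Rightarrow> ('a \<Rightarrow> real) \<Rightarrow> real" where
  "weight_AZ G w = pair_sum (edges G) (\<lambda>u v. (w u * w v / (w u + w v - 2)) ^ 3)"

definition T_GA :: "'a ugraph \<Rightarrow> real" where "T_GA G = weight_GA G (transmission G)"
definition T_AG :: "'a ugraph \<Rightarrow> real" where "T_AG G = weight_AG G (transmission G)"
definition T_SC :: "'a ugraph \<Rightarrow> real" where "T_SC G = weight_SC G (transmission G)"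
definition T_ABC :: "'a ugraph \<Rightarrow> real" where "T_ABC G = weight_ABC G (transmission G)"
definition T_AZ :: "'a ugraph \<Rightarrow> real" where "T_AZ G = weight_AZ G (transmission G)"

definition RT_GA :: "'a ugraph \<Rightarrow> real" where "RT_GA G = weight_GA G (reciprocal_transmission G)"
definition RT_AG :: "'a ugraph \<Rightarrow> real" where "RT_AG G = weight_AG G (reciprocal_transmission G)"
definition RT_SC :: "'a ugraph \<Rightarrow> real" where "RT_SC G = weight_SC G (reciprocal_transmission G)"
definition RT_ABC :: "'a ugraph \<Rightarrow> real" where "RT_ABC G = weight_ABC G (reciprocal_transmission G)"
definition RT_AZ :: "'a ugraph \<Rightarrow> real" where "RT_AZ G = weight_AZ G (reciprocal_transmission G)"

end

theory Submission
  imports Defs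
begin

text \<open>Every index in question is a sum, over pairs or over edges, of an expression in distances,
  degrees and transmissions. If a graph on \<open>N\<close> vertices is \<open>r\<close>-regular and any two distinct
  non-adjacent vertices have a common neighbour, then distances between distinct vertices are \<open>1\<close>
  on edges and \<open>2\<close> elsewhere. All vertices then have transmission \<open>r + 2 (N - 1 - r)\<close> and
  reciprocal transmission \<open>r + (N - 1 - r) / 2\<close>, so the summands take at most two values, one
  on edges and one on the other pairs, and each sum follows from the number \<open>N r / 2\<close> of edges
  and the number \<open>N (N - 1) / 2\<close> of pairs.

  It remains to see that the complement of the circulant graph is such a graph. The residues
  \<open>\<plusminus>m\<^sup>i\<close> with \<open>i < h\<close> are distinct modulo \<open>n = m\<^sup>h\<close>, because
  \<open>m\<^sup>i + m\<^sup>j \<le> 2 m\<^bsup>h-1\<^esup> < n\<close>; hence the circulant graph is \<open>2 h\<close>-regular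
  (\<open>regular_circulant\<close>). The two excluded cases are exactly those with \<open>n \<le> 4 h\<close>. When
  \<open>n > 4 h\<close>, two vertices adjacent in the circulant graph have together at most \<open>4 h\<close>
  neighbours there, themselves included, so some vertex is joined to neither and is a common
  neighbour in the complement (\<open>complement_diameter_two\<close>).\<close>

section \<open>Regular graphs\<close>

locale regular_ugraph =
  fixes G :: "'a ugraph" and r :: nat
  assumes finite_verts: "finite (verts G)"
    and edges_pairs: "edges G \<subseteq> vertex_pairs G"
    and regular: "v \<in> verts G \<Longrightarrow> card {u \<in> verts G. {u, v} \<in> edges G} = r"
begin

lemma finite_vertex_pairs: "finite (vertex_pairs G)"
  by (rule finite_subset[of _ "Pow (verts G)"]) (auto simp: vertex_pairs_def finite_verts)

lemma finite_edges: "finite (edges G)"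
  using finite_subset[OF edges_pairs finite_vertex_pairs] .

lemma edge_verts:
  assumes "{u, v} \<in> edges G"
  shows "u \<in> verts G" "v \<in> verts G" "u \<noteq> v"
  using assms edges_pairs by (auto simp: vertex_pairs_def doubleton_eq_iff)

lemma degree_eq:
  assumes "v \<in> verts G"
  shows "degree G v = r"
proof -
  have "{e \<in> edges G. v \<in> e} = (\<lambda>u. {u, v}) ` {u \<in> verts G. {u, v} \<in> edges G}"
    using edges_pairs by (fastforce simp: vertex_pairs_def insert_commute)
  moreover have "inj_on (\<lambda>u. {u, v}) {u \<in> verts G. {u, v} \<in> edges G}"
    by (auto simp: inj_on_def doubleton_eq_iff)
  ultimately show ?thesis
    by (simp add: degree_def card_image regular assms)
qed

text \<open>The handshake lemma: count the incidences of vertices with edges in two ways.\<close>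

lemma card_edges: "real (card (edges G)) = real (card (verts G)) * real r / 2"
proof -
  have "card {v \<in> verts G. v \<in> e} = 2" if e: "e \<in> edges G" for e
  proof -
    obtain u v where "e = {u, v}" "u \<in> verts G" "v \<in> verts G" "u \<noteq> v"
      using e edges_pairs by (auto simp: vertex_pairs_def)
    moreover from this have "{x \<in> verts G. x \<in> e} = {u, v}" by auto
    ultimately show ?thesis by simp
  qed
  then have "(\<Sum>v\<in>verts G. card {e \<in> edges G. v \<in> e}) = 2 * card (edges G)"
    by (intro sum_multicount finite_verts finite_edges) auto
  also have "(\<Sum>v\<in>verts G. card {e \<in> edges G. v \<in> e}) = card (verts G) * r"
    using degree_eq by (simp add: degree_def)
  finally have "2 * card (edges G) = card (verts G) * r" by simp
  then have "real (2 * card (edges G)) = real (card (verts G) * r)" by (simp only:)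
  then show ?thesis by simp
qed

end

lemma card_vertex_pairs:
  assumes "finite (verts G)"
  shows "real (card (vertex_pairs G)) = real (card (verts G)) * (real (card (verts G)) - 1) / 2"
proof -
  have "vertex_pairs G = {e. e \<subseteq> verts G \<and> card e = 2}"
    by (fastforce simp: vertex_pairs_def card_2_iff)
  then have "card (vertex_pairs G) = card (verts G) choose 2"
    using n_subsets[OF assms] by simp
  then have "2 * card (vertex_pairs G) = card (verts G) * (card (verts G) - 1)"
    using even_mult_iff[of "card (verts G)" "card (verts G) - 1"]
    by (cases "even (card (verts G))") (auto simp: choose_two)
  then have "real (2 * card (vertex_pairs G)) = real (card (verts G) * (card (verts G) - 1))"
    by (simp only:)
  then show ?thesis by (cases "card (verts G)") (simp_all add: algebra_simps)
qed

lemma pair_sum_const: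
  assumes "P \<subseteq> vertex_pairs G" and "\<And>u v. {u, v} \<in> P \<Longrightarrow> f u v = c"
  shows "pair_sum P f = real (card P) * c"
proof -
  have "on_pair f e = c" if eP: "e \<in> P" for e
  proof -
    obtain u v where e: "e = {u, v}" using eP assms(1) by (auto simp: vertex_pairs_def)
    have "f u v = c" "f v u = c"
      using eP assms(2) by (auto simp: e insert_commute)
    then show ?thesis by (simp add: e on_pair_eq)
  qed
  then show ?thesis by (simp add: pair_sum_def)
qed

section \<open>Distances in regular graphs of diameter two\<close>

text \<open>The last condition bounds the diameter by two from above; complete graphs are included.\<close>

locale regular_diameter_two = regular_ugraph +
  assumes common_neighbour:
    "\<lbrakk>u \<in> verts G; v \<in> verts G; u \<noteq> v; {u, v} \<notin> edges G\<rbrakk>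
      \<Longrightarrow> \<exists>w. {u, w} \<in> edges G \<and> {w, v} \<in> edges G"
begin

lemma walk_length_two_iff:
  "walk_betw G u p v \<and> length p = 2 \<longleftrightarrow> p = [u, v] \<and> {u, v} \<in> edges G"
  by (auto simp: walk_betw_def numeral_2_eq_2 length_Suc_conv edge_verts)

lemma connected:
  assumes "verts G \<noteq> {}"
  shows "connected_ugraph G"
  unfolding connected_ugraph_def
proof (intro conjI ballI)
  fix u v assume uv: "u \<in> verts G" "v \<in> verts G"
  show "\<exists>p. walk_betw G u p v"
  proof (cases "u = v")
    case True
    then have "walk_betw G u [u] v" using uv by (simp add: walk_betw_def)
    then show ?thesis ..
  next
    case ne: False
    show ?thesis
    proof (cases "{u, v} \<in> edges G")
      case True
      then show ?thesis using walk_length_two_iff by blast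
    next
      case False
      then obtain w where w: "{u, w} \<in> edges G" "{w, v} \<in> edges G"
        using common_neighbour uv ne by blast
      then have "walk_betw G u [u, w, v] v"
        using edge_verts[OF w(1)] uv by (simp add: walk_betw_def)
      then show ?thesis ..
    qed
  qed
qed (fact assms)

lemma gdist_eq:
  assumes uv: "u \<in> verts G" "v \<in> verts G" and ne: "u \<noteq> v"
  shows "gdist G u v = (if {u, v} \<in> edges G then 1 else 2)"
proof -
  have pos: "k \<noteq> 0" if "\<exists>p. walk_betw G u p v \<and> length p = Suc k" for k
    using that ne by (auto simp: walk_betw_def length_Suc_conv)
  show ?thesis
  proof (cases "{u, v} \<in> edges G")
    case True
    then have "walk_betw G u [u, v] v \<and> length [u, v] = 2"
      using walk_length_two_iff by blast
    then have "\<exists>p. walk_betw G u p v \<and> length p = Suc 1"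
      by (intro exI[of _ "[u, v]"]) simp
    then have "gdist G u v = 1"
      unfolding gdist_def by (rule Least_equality) (use pos in force)
    then show ?thesis using True by simp
  next
    case False
    then obtain w where w: "{u, w} \<in> edges G" "{w, v} \<in> edges G"
      using common_neighbour assms by blast
    then have "walk_betw G u [u, w, v] v"
      using edge_verts[OF w(1)] uv by (simp add: walk_betw_def)
    then have walk: "\<exists>p. walk_betw G u p v \<and> length p = Suc 2"
      by (intro exI[of _ "[u, w, v]"]) simp
    have "k \<noteq> 1" if "\<exists>p. walk_betw G u p v \<and> length p = Suc k" for k
      using that False walk_length_two_iff by (auto simp: numeral_2_eq_2)
    with pos have "2 \<le> k" if "\<exists>p. walk_betw G u p v \<and> length p = Suc k" for k
      using that by (metis One_nat_def Suc_1 Suc_leI le_neq_implies_less not_gr_zero)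
    with walk have "gdist G u v = 2"
      unfolding gdist_def by (intro Least_equality)
    then show ?thesis using False by simp
  qed
qed

text \<open>Both transmissions are sums of this kind, with \<open>f d = d\<close> and with \<open>f d = 1 / d\<close>.\<close>

lemma sum_gdist:
  fixes f :: "nat \<Rightarrow> real"
  assumes v: "v \<in> verts G"
  shows "(\<Sum>u\<in>verts G - {v}. f (gdist G u v))
    = real r * f 1 + (real (card (verts G)) - 1 - real r) * f 2"
proof -
  define A where "A = {u \<in> verts G. {u, v} \<in> edges G}"
  have sub: "A \<subseteq> verts G - {v}" using edge_verts(3) by (auto simp: A_def)
  have A: "card A = r" using regular[OF v] by (simp add: A_def)
  have "card (verts G) = Suc (card (verts G - {v}))"
    using v finite_verts by (simp only: card_Suc_Diff1)
  moreover have "card (verts G - {v} - A) = card (verts G - {v}) - r" "r \<le> card (verts G - {v})"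
    using sub finite_verts A by (auto simp: card_Diff_subset finite_subset intro: card_mono)
  ultimately have B: "real (card (verts G - {v} - A)) = real (card (verts G)) - 1 - real r"
    by simp
  have "(\<Sum>u\<in>verts G - {v}. f (gdist G u v))
      = (\<Sum>u\<in>verts G - {v} - A. f (gdist G u v)) + (\<Sum>u\<in>A. f (gdist G u v))"
    using sub finite_verts by (intro sum.subset_diff) auto
  also have "(\<Sum>u\<in>verts G - {v} - A. f (gdist G u v)) = (\<Sum>u\<in>verts G - {v} - A. f 2)"
    using v by (intro sum.cong) (auto simp: gdist_eq A_def)
  also have "(\<Sum>u\<in>A. f (gdist G u v)) = (\<Sum>u\<in>A. f 1)"
    using v edge_verts(3) by (intro sum.cong) (auto simp: gdist_eq A_def)
  finally show ?thesis by (simp add: A B)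
qed

lemma gdist_commute: "gdist G u v = gdist G v u" if "u \<in> verts G" "v \<in> verts G"
  using that by (cases "u = v") (simp_all add: gdist_eq insert_commute)

lemma transmission_eq:
  assumes "v \<in> verts G"
  shows "transmission G v = 2 * (real (card (verts G)) - 1) - real r"
  using sum_gdist[OF assms, of real] gdist_commute assms
  by (simp add: transmission_def algebra_simps)

lemma reciprocal_transmission_eq:
  assumes "v \<in> verts G"
  shows "reciprocal_transmission G v = (real (card (verts G)) - 1 + real r) / 2"
  using sum_gdist[OF assms, of "\<lambda>d. 1 / real d"] gdist_commute assms
  by (simp add: reciprocal_transmission_def field_simps)

section \<open>Topological indices of regular graphs of diameter two\<close>

text \<open>All seven distance-based indices are instances of this formula, because the degrees are
  constant.\<close>

lemma pair_sum_vertex_pairs: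
  assumes edge: "\<And>u v. {u, v} \<in> edges G \<Longrightarrow> f u v = a"
    and non_edge:
      "\<And>u v. \<lbrakk>u \<in> verts G; v \<in> verts G; u \<noteq> v; {u, v} \<notin> edges G\<rbrakk> \<Longrightarrow> f u v = b"
  shows "pair_sum (vertex_pairs G) f
    = real (card (verts G)) / 2 * (real r * a + (real (card (verts G)) - 1 - real r) * b)"
proof -
  have "pair_sum (vertex_pairs G) f
      = pair_sum (vertex_pairs G - edges G) f + pair_sum (edges G) f"
    unfolding pair_sum_def
    by (intro sum.subset_diff edges_pairs finite_vertex_pairs)
  also have "pair_sum (edges G) f = real (card (edges G)) * a"
    by (intro pair_sum_const[OF edges_pairs] edge)
  also have "pair_sum (vertex_pairs G - edges G) f
      = real (card (vertex_pairs G - edges G)) * b"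
    by (intro pair_sum_const[OF Diff_subset] non_edge)
      (auto simp: vertex_pairs_def doubleton_eq_iff)
  also have "real (card (vertex_pairs G - edges G))
      = real (card (vertex_pairs G)) - real (card (edges G))"
    by (simp add: card_Diff_subset[OF finite_edges edges_pairs]
        card_mono[OF finite_vertex_pairs edges_pairs] of_nat_diff)
  finally show ?thesis
    by (simp add: card_edges card_vertex_pairs finite_verts field_simps)
qed

text \<open>The terms with \<open>\<rho>\<close> and with \<open>N - 1 - \<rho>\<close> in front are the contributions of the neighbours
  and of the non-neighbours of one vertex.\<close>

lemma distance_indices:
  fixes N \<rho> :: real
  defines "N \<equiv> real (card (verts G))" and "\<rho> \<equiv> real r"
  shows "wiener G = N / 2 * (\<rho> + (N - 1 - \<rho>) * 2)"
    and "hyper_wiener G = N / 2 * (\<rho> + (N - 1 - \<rho>) * 3)"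
    and "harary G = N / 2 * (\<rho> + (N - 1 - \<rho>) / 2)"
    and "schultz G = N / 2 * (\<rho> * (2 * \<rho>) + (N - 1 - \<rho>) * (4 * \<rho>))"
    and "gutman G = N / 2 * (\<rho> * \<rho>\<^sup>2 + (N - 1 - \<rho>) * (2 * \<rho>\<^sup>2))"
    and "harary_add G = N / 2 * (\<rho> * (2 * \<rho>) + (N - 1 - \<rho>) * \<rho>)"
    and "harary_mult G = N / 2 * (\<rho> * \<rho>\<^sup>2 + (N - 1 - \<rho>) * (\<rho>\<^sup>2 / 2))"
proof -
  note defs = N_def \<rho>_def
  note vals = gdist_eq degree_eq edge_verts power2_eq_square
  show "wiener G = N / 2 * (\<rho> + (N - 1 - \<rho>) * 2)"
    unfolding wiener_def defs
    by (subst pair_sum_vertex_pairs[where a = 1 and b = 2]) (simp_all add: vals)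
  show "hyper_wiener G = N / 2 * (\<rho> + (N - 1 - \<rho>) * 3)"
    unfolding hyper_wiener_def defs
    by (subst pair_sum_vertex_pairs[where a = 2 and b = 6]) (simp_all add: vals field_simps)
  show "harary G = N / 2 * (\<rho> + (N - 1 - \<rho>) / 2)"
    unfolding harary_def defs
    by (subst pair_sum_vertex_pairs[where a = 1 and b = "1 / 2"]) (simp_all add: vals)
  show "schultz G = N / 2 * (\<rho> * (2 * \<rho>) + (N - 1 - \<rho>) * (4 * \<rho>))"
    unfolding schultz_def defs
    by (subst pair_sum_vertex_pairs[where a = "2 * real r" and b = "4 * real r"])
      (simp_all add: vals)
  show "gutman G = N / 2 * (\<rho> * \<rho>\<^sup>2 + (N - 1 - \<rho>) * (2 * \<rho>\<^sup>2))"
    unfolding gutman_def defs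
    by (subst pair_sum_vertex_pairs[where a = "(real r)\<^sup>2" and b = "2 * (real r)\<^sup>2"])
      (simp_all add: vals)
  show "harary_add G = N / 2 * (\<rho> * (2 * \<rho>) + (N - 1 - \<rho>) * \<rho>)"
    unfolding harary_add_def defs
    by (subst pair_sum_vertex_pairs[where a = "2 * real r" and b = "real r"])
      (simp_all add: vals)
  show "harary_mult G = N / 2 * (\<rho> * \<rho>\<^sup>2 + (N - 1 - \<rho>) * (\<rho>\<^sup>2 / 2))"
    unfolding harary_mult_def defs
    by (subst pair_sum_vertex_pairs[where a = "(real r)\<^sup>2" and b = "(real r)\<^sup>2 / 2"])
      (simp_all add: vals)
qed

end

text \<open>For a constant vertex weight every edge contributes the same, so only the number of edges
  matters.\<close>

lemma (in regular_ugraph) weight_indices: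
  fixes c :: real
  assumes w: "\<forall>v\<in>verts G. w v = c" and c: "c > 0"
  defines "M \<equiv> real (card (verts G)) * real r / 2"
  shows "weight_AG G w = M"
    and "weight_GA G w = M"
    and "weight_SC G w = M / (sqrt 2 * sqrt c)"
    and "weight_ABC G w = M * sqrt 2 * sqrt (c - 1) / c"
    and "weight_AZ G w = M * c ^ 6 / (8 * (c - 1) ^ 3)"
proof -
  have sum: "pair_sum (edges G) f = M * a" if "\<And>u v. {u, v} \<in> edges G \<Longrightarrow> f u v = a" for f a
    using pair_sum_const[OF edges_pairs that] by (simp add: card_edges M_def)
  note weights = bspec[OF w edge_verts(1)] bspec[OF w edge_verts(2)]
  show "weight_AG G w = M"
    unfolding weight_AG_def using c by (subst sum[where a = 1]) (simp_all add: weights)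
  show "weight_GA G w = M"
    unfolding weight_GA_def using c by (subst sum[where a = 1]) (simp_all add: weights)
  show "weight_SC G w = M / (sqrt 2 * sqrt c)"
    unfolding weight_SC_def
    by (subst sum[where a = "1 / (sqrt 2 * sqrt c)"])
      (simp_all add: weights flip: real_sqrt_mult mult_2)
  have "sqrt ((c + c - 2) / (c * c)) = sqrt 2 * sqrt (c - 1) / c"
    using c by (simp add: real_sqrt_divide algebra_simps flip: real_sqrt_mult)
  then show "weight_ABC G w = M * sqrt 2 * sqrt (c - 1) / c"
    unfolding weight_ABC_def
    by (subst sum[where a = "sqrt 2 * sqrt (c - 1) / c"]) (simp_all add: weights)
  have "(c * c / (c + c - 2)) ^ 3 = c ^ 6 / (8 * (c - 1) ^ 3)"
  proof -
    have "c + c - 2 = 2 * (c - 1)" by simp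
    then have "(c * c / (c + c - 2)) ^ 3 = (c * c) ^ 3 / (2 * (c - 1)) ^ 3"
      by (simp only: power_divide)
    also have "\<dots> = c ^ 6 / (8 * (c - 1) ^ 3)"
      by (simp only: power_mult_distrib flip: power_add) simp
    finally show ?thesis .
  qed
  then show "weight_AZ G w = M * c ^ 6 / (8 * (c - 1) ^ 3)"
    unfolding weight_AZ_def
    by (subst sum[where a = "c ^ 6 / (8 * (c - 1) ^ 3)"]) (simp_all add: weights)
qed

section \<open>Complements of sparse regular graphs\<close>

lemma complement_edge_iff:
  "{u, v} \<in> edges (complement G)
    \<longleftrightarrow> u \<in> verts G \<and> v \<in> verts G \<and> u \<noteq> v \<and> {u, v} \<notin> edges G"
  by (auto simp: complement_def doubleton_eq_iff insert_commute)

text \<open>The neighbourhoods of two adjacent vertices contain these two vertices and cover at most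
  \<open>2 r\<close> vertices. A vertex outside them is a common neighbour in the complement.\<close>

lemma (in regular_ugraph) complement_diameter_two:
  assumes sparse: "2 * r < card (verts G)"
  shows "regular_diameter_two (complement G) (card (verts G) - 1 - r)"
proof
  have verts: "verts (complement G) = verts G" by (simp add: complement_def)
  show "finite (verts (complement G))" by (simp add: verts finite_verts)
  show "edges (complement G) \<subseteq> vertex_pairs (complement G)"
    by (auto simp: complement_def vertex_pairs_def)
  fix v assume v: "v \<in> verts (complement G)"
  let ?N = "\<lambda>v. {u \<in> verts G. {u, v} \<in> edges G}"
  have "{u \<in> verts G. {u, v} \<in> edges (complement G)} = verts G - {v} - ?N v"
    using v by (auto simp: complement_edge_iff verts)
  moreover have "?N v \<subseteq> verts G - {v}" using edge_verts(3) by auto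
  ultimately show
    "card {u \<in> verts (complement G). {u, v} \<in> edges (complement G)} = card (verts G) - 1 - r"
    using v finite_verts regular
    by (simp add: verts card_Diff_subset)
next
  have verts: "verts (complement G) = verts G" by (simp add: complement_def)
  let ?N = "\<lambda>v. {u \<in> verts G. {u, v} \<in> edges G}"
  fix u v
  assume uv: "u \<in> verts (complement G)" "v \<in> verts (complement G)" "u \<noteq> v"
    and "{u, v} \<notin> edges (complement G)"
  then have uv_edge: "{u, v} \<in> edges G" by (simp add: complement_edge_iff verts)
  have "card (?N u \<union> ?N v) \<le> 2 * r"
    using card_Un_le[of "?N u" "?N v"] regular uv by (simp add: verts)
  then have "\<not> verts G \<subseteq> ?N u \<union> ?N v"
    using sparse card_mono[of "?N u \<union> ?N v" "verts G"] finite_verts by auto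
  then obtain w where w: "w \<in> verts G" "{w, u} \<notin> edges G" "{w, v} \<notin> edges G" by auto
  then have "w \<noteq> u" "w \<noteq> v" using uv_edge by (auto simp: insert_commute)
  then show "\<exists>w. {u, w} \<in> edges (complement G) \<and> {w, v} \<in> edges (complement G)"
    using w uv by (intro exI[of _ w]) (auto simp: complement_edge_iff verts insert_commute)
qed

section \<open>Circulant graphs\<close>

text \<open>The steps from a vertex to its neighbours are the residues \<open>s\<close> and \<open>n - s\<close> for \<open>s \<in> S\<close>.
  Since no two elements of \<open>S\<close> add up to \<open>n\<close>, they are \<open>2 |S|\<close> distinct residues.\<close>

lemma regular_circulant:
  assumes S: "S \<subseteq> {1..<n}" and no_opposite: "\<And>s t. \<lbrakk>s \<in> S; t \<in> S\<rbrakk> \<Longrightarrow> s + t \<noteq> n"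
  shows "regular_ugraph (circulant n S) (2 * card S)"
proof
  have verts: "verts (circulant n S) = {..<n}"
    and edges: "edges (circulant n S) = {{g, (g + s) mod n} | g s. g < n \<and> s \<in> S}"
    by (simp_all add: circulant_def)
  have step: "(g + s) mod n = (if g + s < n then g + s else g + s - n)"
    if "g < n" "s < n" for g s
    using that by (simp add: mod_if)
  show "finite (verts (circulant n S))" by (simp add: verts)
  show "edges (circulant n S) \<subseteq> vertex_pairs (circulant n S)"
  proof
    fix e assume "e \<in> edges (circulant n S)"
    then obtain g s where e: "e = {g, (g + s) mod n}" "g < n" "s \<in> S" by (auto simp: edges)
    then have "0 < s" "s < n" using S by auto
    then have "(g + s) mod n \<noteq> g" "(g + s) mod n < n" using e by (auto simp: step)
    then show "e \<in> vertex_pairs (circulant n S)"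
      unfolding vertex_pairs_def verts e using e(2) by blast
  qed
  fix v assume "v \<in> verts (circulant n S)"
  then have v: "v < n" by (simp add: verts)
  let ?T = "S \<union> (\<lambda>s. n - s) ` S"
  have T: "?T \<subseteq> {..<n}" using S by fastforce
  have "{u \<in> verts (circulant n S). {u, v} \<in> edges (circulant n S)} = (\<lambda>t. (v + t) mod n) ` ?T"
    (is "?L = ?R")
  proof
    show "?L \<subseteq> ?R"
    proof
      fix u assume "u \<in> ?L"
      then obtain s where u: "u < n" and s: "s \<in> S"
        and "v = (u + s) mod n \<or> u = (v + s) mod n"
        by (auto simp: verts edges doubleton_eq_iff)
      then consider "v = (u + s) mod n" | "u = (v + s) mod n" by blast
      then show "u \<in> ?R"
      proof cases
        case 1
        have "0 < s" "s < n" using s S by auto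
        then have "u = (v + (n - s)) mod n" using 1 u v by (auto simp: step split: if_splits)
        then show ?thesis using s by blast
      next
        case 2
        then show ?thesis using s by blast
      qed
    qed
    show "?R \<subseteq> ?L"
    proof
      fix u assume "u \<in> ?R"
      then obtain s where s: "s \<in> S" and "u = (v + s) mod n \<or> u = (v + (n - s)) mod n" by blast
      then consider "u = (v + s) mod n" | "u = (v + (n - s)) mod n" by blast
      then show "u \<in> ?L"
      proof cases
        case 1
        then have "{u, v} \<in> edges (circulant n S)"
          using s v by (auto simp: edges insert_commute)
        then show ?thesis using 1 v by (simp add: verts)
      next
        case 2
        have "0 < s" "s < n" using s S by auto
        then have "u = (if v < s then v + (n - s) else v - s)"
          using 2 v step[of v "n - s"] by (auto split: if_splits)
        then have u: "v = (u + s) mod n" "u < n"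
          using v \<open>0 < s\<close> \<open>s < n\<close> by (auto simp: step split: if_splits)
        then have "{u, v} \<in> edges (circulant n S)" using s by (auto simp: edges)
        then show ?thesis using u by (simp add: verts)
      qed
    qed
  qed
  moreover have "inj_on (\<lambda>t. (v + t) mod n) ?T"
  proof (rule inj_on_subset[OF _ T])
    show "inj_on (\<lambda>t. (v + t) mod n) {..<n}"
      using v by (auto simp: inj_on_def step split: if_splits)
  qed
  moreover have "card ?T = 2 * card S"
  proof -
    have "S \<inter> (\<lambda>s. n - s) ` S = {}" using no_opposite S by fastforce
    moreover have "inj_on (\<lambda>s. n - s) S"
      using S by (fastforce simp: inj_on_def)
    moreover have "finite S" using S finite_subset by blast
    ultimately show ?thesis by (simp add: card_Un_disjoint card_image)
  qed
  ultimately show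
    "card {u \<in> verts (circulant n S). {u, v} \<in> edges (circulant n S)} = 2 * card S"
    by (simp add: card_image)
qed

lemma regular_power_circulant:
  fixes m h :: nat
  assumes m: "m \<ge> 3"
  shows "regular_ugraph (circulant (m ^ h) {m ^ i | i. i < h}) (2 * h)"
proof -
  let ?S = "{m ^ i | i. i < h}"
  have S: "?S = (\<lambda>i. m ^ i) ` {..<h}" by auto
  \<comment> \<open>Two elements that are at most a third of \<open>m ^ h\<close> cannot add up to \<open>m ^ h\<close>.\<close>
  have small: "3 * s \<le> m ^ h" if s: "s \<in> ?S" for s
  proof -
    obtain i where i: "s = m ^ i" "i < h" using s by blast
    have "3 * m ^ i \<le> m ^ Suc i" using m by simp
    also have "\<dots> \<le> m ^ h" using i m by (intro power_increasing) auto
    finally show ?thesis by (simp add: i)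
  qed
  have pos: "0 < s" if "s \<in> ?S" for s using that m by auto
  have "?S \<subseteq> {1..<m ^ h}"
  proof
    fix s assume "s \<in> ?S"
    from small[OF this] pos[OF this] show "s \<in> {1..<m ^ h}" by simp
  qed
  moreover have "s + t \<noteq> m ^ h" if "s \<in> ?S" "t \<in> ?S" for s t
    using small[OF that(1)] small[OF that(2)] pos[OF that(1)] pos[OF that(2)] by linarith
  moreover have "card ?S = h"
    using m by (simp add: S card_image inj_on_def)
  ultimately show ?thesis using regular_circulant[of ?S "m ^ h"] by simp
qed

lemma four_mult_less_power:
  fixes m h :: nat
  assumes m: "m \<ge> 3" and h: "h \<ge> 1" and excluded: "(m, h) \<notin> {(3, 1), (4, 1)}"
  shows "4 * h < m ^ h"
proof (cases "h = 1")
  case True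
  then show ?thesis using m excluded by auto
next
  case False
  have "4 * k < 3 ^ k" if "2 \<le> k" for k :: nat
    using that by (induction k rule: dec_induct) auto
  then have "4 * h < 3 ^ h" using False h by simp
  also have "(3::nat) ^ h \<le> m ^ h" using m by (rule power_mono) simp
  finally show ?thesis .
qed

theorem corollary5p9:
  fixes m h n :: nat and G :: "nat ugraph"
  assumes "m \<ge> 3" and "h \<ge> 1" and "(m, h) \<notin> {(3, 1), (4, 1)}"
    and "n = m ^ h"
    and "G = complement (circulant n {m ^ i | i. i < h})"
  shows "connected_ugraph G
     \<and> wiener G = real n * (real n + 2 * real h - 1) / 2
     \<and> schultz G = real n * (real n - 2 * real h - 1) * (real n + 2 * real h - 1)
     \<and> gutman G = real n * (real n + 2 * real h - 1) * (real n - 2 * real h - 1) ^ 2 / 2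
     \<and> hyper_wiener G = real n * (real n + 4 * real h - 1) / 2
     \<and> harary G = real n * (real n - real h - 1) / 2
     \<and> harary_add G = real n * (real n - 2 * real h - 1) * (real n - real h - 1)
     \<and> harary_mult G = real n * (real n - real h - 1) * (real n - 2 * real h - 1) ^ 2 / 2
     \<and> T_AG G = real n * (real n - 2 * real h - 1) / 2
     \<and> T_GA G = real n * (real n - 2 * real h - 1) / 2
     \<and> T_SC G = real n * (real n - 2 * real h - 1)
           / (2 * sqrt 2 * sqrt (real n + 2 * real h - 1))
     \<and> T_ABC G = real n * (real n - 2 * real h - 1) * sqrt (real n + 2 * real h - 2)
           / (sqrt 2 * (real n + 2 * real h - 1))
     \<and> T_AZ G = real n * (real n - 2 * real h - 1) * (real n + 2 * real h - 1) ^ 6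
           / (16 * (real n + 2 * real h - 2) ^ 3)
     \<and> RT_AG G = real n * (real n - 2 * real h - 1) / 2
     \<and> RT_GA G = real n * (real n - 2 * real h - 1) / 2
     \<and> RT_SC G = real n * (real n - 2 * real h - 1)
           / (2 * sqrt 2 * sqrt (real n - real h - 1))
     \<and> RT_ABC G = real n * (real n - 2 * real h - 1) * sqrt (real n - real h - 2)
           / (sqrt 2 * (real n - real h - 1))
     \<and> RT_AZ G = real n * (1 + 2 * real h - real n) * (1 + real h - real n) ^ 6
           / (16 * (2 + real h - real n) ^ 3)"
proof -
  have n: "4 * h < n"
    using four_mult_less_power[OF assms(1-3)] assms(4) by simp
  define C where "C = circulant n {m ^ i | i. i < h}"
  interpret C: regular_ugraph C "2 * h"
    using regular_power_circulant[OF assms(1)] by (simp add: C_def assms(4))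
  have verts_C: "verts C = {..<n}" by (simp add: C_def circulant_def)
  have GC: "G = complement C" by (simp add: assms(5) C_def)
  have verts_G: "verts G = {..<n}" by (simp add: GC complement_def verts_C)
  interpret G: regular_diameter_two G "n - 1 - 2 * h"
    using C.complement_diameter_two n by (simp add: GC verts_C)
  have r: "real (n - 1 - 2 * h) = real n - 2 * real h - 1" using n by linarith
  have N: "card (verts G) = n" by (simp add: verts_G)
  define \<sigma> where "\<sigma> = real n + 2 * real h - 1"
  define \<rho> where "\<rho> = real n - real h - 1"
  have pos: "\<sigma> > 0" "\<rho> > 0" using n assms(2) by (simp_all add: \<sigma>_def \<rho>_def)
  have \<sigma>: "\<forall>v\<in>verts G. transmission G v = \<sigma>"
    using G.transmission_eq[unfolded N r]
    by (simp add: \<sigma>_def)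
  have \<rho>: "\<forall>v\<in>verts G. reciprocal_transmission G v = \<rho>"
  proof
    fix v assume "v \<in> verts G"
    then show "reciprocal_transmission G v = \<rho>"
      by (simp add: G.reciprocal_transmission_eq[unfolded N r] \<rho>_def)
  qed
  note T = G.weight_indices[OF \<sigma> pos(1), unfolded N r]
  note RT = G.weight_indices[OF \<rho> pos(2), unfolded N r]
  note D = G.distance_indices[unfolded N r]
  have \<sigma>1: "real n + 2 * real h - 2 = \<sigma> - 1" and \<rho>1: "real n - real h - 2 = \<rho> - 1"
    by (simp_all add: \<sigma>_def \<rho>_def)
  have abc: "x / 2 * sqrt 2 * y / z = x * y / (sqrt 2 * z)" for x y z :: real
  proof -
    have "x / 2 * sqrt 2 = x / sqrt 2" by (simp add: field_simps)
    then show ?thesis by (simp del: times_divide_eq_left) simp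
  qed
  \<comment> \<open>The last formula negates the factors of this fraction; the negated powers have degrees
    \<open>1\<close>, \<open>6\<close> and \<open>3\<close>, so the signs cancel.\<close>
  have az: "real n * (1 + 2 * real h - real n) * (1 + real h - real n) ^ 6
      / (16 * (2 + real h - real n) ^ 3)
    = real n * (real n - 2 * real h - 1) / 2 * \<rho> ^ 6 / (8 * (\<rho> - 1) ^ 3)"
  proof -
    have "1 + 2 * real h - real n = - (real n - 2 * real h - 1)"
      and "1 + real h - real n = - \<rho>" and "2 + real h - real n = - (\<rho> - 1)"
      by (simp_all add: \<rho>_def)
    moreover have "(- \<rho>) ^ 6 = \<rho> ^ 6" and "(- (\<rho> - 1)) ^ 3 = - ((\<rho> - 1) ^ 3)"
      by (rule power_minus_even power_minus_odd, simp)+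
    moreover have "x * (- d) * p / (16 * (- q)) = x * d / 2 * p / (8 * q)" for x d p q :: real
      by simp
    ultimately show ?thesis
      by (simp only:)
  qed
  show ?thesis
  proof (intro conjI)
    show "connected_ugraph G"
      using n by (intro G.connected) (auto simp: verts_G)
    show "T_ABC G = real n * (real n - 2 * real h - 1) * sqrt (real n + 2 * real h - 2)
        / (sqrt 2 * (real n + 2 * real h - 1))"
      unfolding T_ABC_def T(4) abc \<sigma>1 by (simp only: \<sigma>_def)
    show "RT_ABC G = real n * (real n - 2 * real h - 1) * sqrt (real n - real h - 2)
        / (sqrt 2 * (real n - real h - 1))"
      unfolding RT_ABC_def RT(4) abc \<rho>1 by (simp only: \<rho>_def)
    show "T_AZ G = real n * (real n - 2 * real h - 1) * (real n + 2 * real h - 1) ^ 6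
        / (16 * (real n + 2 * real h - 2) ^ 3)"
      unfolding T_AZ_def T(5) \<sigma>1 by (simp add: \<sigma>_def)
    show "RT_AZ G = real n * (1 + 2 * real h - real n) * (1 + real h - real n) ^ 6
        / (16 * (2 + real h - real n) ^ 3)"
      unfolding RT_AZ_def RT(5) az ..
    show "T_SC G = real n * (real n - 2 * real h - 1)
        / (2 * sqrt 2 * sqrt (real n + 2 * real h - 1))"
      unfolding T_SC_def T(3) by (simp add: \<sigma>_def mult.assoc)
    show "RT_SC G = real n * (real n - 2 * real h - 1) / (2 * sqrt 2 * sqrt (real n - real h - 1))"
      unfolding RT_SC_def RT(3) by (simp add: \<rho>_def mult.assoc)
    show "wiener G = real n * (real n + 2 * real h - 1) / 2"
      unfolding D by (simp add: field_simps power2_eq_square)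
    show "schultz G = real n * (real n - 2 * real h - 1) * (real n + 2 * real h - 1)"
      unfolding D by (simp add: field_simps power2_eq_square)
    show "gutman G = real n * (real n + 2 * real h - 1) * (real n - 2 * real h - 1) ^ 2 / 2"
      unfolding D by (simp add: field_simps power2_eq_square)
    show "hyper_wiener G = real n * (real n + 4 * real h - 1) / 2"
      unfolding D by (simp add: field_simps power2_eq_square)
    show "harary G = real n * (real n - real h - 1) / 2"
      unfolding D by (simp add: field_simps power2_eq_square)
    show "harary_add G = real n * (real n - 2 * real h - 1) * (real n - real h - 1)"
      unfolding D by (simp add: field_simps power2_eq_square)
    show "harary_mult G = real n * (real n - real h - 1) * (real n - 2 * real h - 1) ^ 2 / 2"
      unfolding D by (simp add: field_simps power2_eq_square)
    show "T_AG G = real n * (real n - 2 * real h - 1) / 2"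
      unfolding T_AG_def T(1) ..
    show "T_GA G = real n * (real n - 2 * real h - 1) / 2"
      unfolding T_GA_def T(2) ..
    show "RT_AG G = real n * (real n - 2 * real h - 1) / 2"
      unfolding RT_AG_def RT(1) ..
    show "RT_GA G = real n * (real n - 2 * real h - 1) / 2"
      unfolding RT_GA_def RT(2) ..
  qed
qed

end
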